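(* For every rational number $q$, the sets $\Pi_s(q)$, $s=0,1,2,\dots$, are pairwise disjoint, and $\bigcup_{s=0}^{\infty}\Pi_s(q)=\Pi\setminus\mathcal D(q)$.
   Context: Chebyshev polynomials: $U_n\in\mathbb Z[q]$ are defined by $U_0=0$, $U_1=1$, $U_{n+1}=qU_n-U_{n-1}$ (equivalently, for every $2\times 2$ matrix $A$ of determinant $1$ and trace $q$, $A^n=U_n(q)A-U_{n-1}(q)I$); $C_n=U_{n+1}-U_{n-1}$ (so $C_0=2$, $C_1=q$, and $C_n(q)$ is the trace of $A^n$); for odd $n=2k+1$, $V_n=U_{k+1}-U_k$ and $W_n=U_{k+1}+U_k$. For a rational $q=a/b$ in lowest terms and a prime $p\nmid b$, "$x\equiv y \bmod p$" for rationals with denominators prime to $p$ means equality of their images in $\mathbb F_p$. $\mathcal D(q)$ is the set of prime divisors of the denominator $b$ of $q$. $\Pi$ is the set of odd primes. For $p\in\Pi\setminus\mathcal D(q)$: $p\in\Pi_0(q)$ if $W_n(q)\equiv 0 \bmod p$ for some odd $n\ge1$; $p\in\Pi_1(q)$ if $V_n(q)\equiv0\bmod p$ for some odd $n\ge1$; $p\in\Pi_{2+k}(q)$ ($k\ge0$) if $C_{2^kn}(q)\equiv0\bmod p$ for some odd $n\ge1$. *)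

theory Defs
  imports
    "HOL-Library.Disjoint_Sets"
    "HOL-Computational_Algebra.Computational_Algebra"
    "HOL-Number_Theory.Number_Theory"
begin

fun cheb_U :: "nat \<Rightarrow> int poly" where
  "cheb_U 0 = 0"
| "cheb_U (Suc 0) = 1"
| "cheb_U (Suc (Suc n)) = [:0, 1:] * cheb_U (Suc n) - cheb_U n"

(* C_n = U_(n+1) - U_(n-1); for n = 0 the recurrence for U run backwards gives U_(-1) = -1. *)
fun cheb_C :: "nat \<Rightarrow> int poly" where
  "cheb_C 0 = 2"
| "cheb_C (Suc n) = cheb_U (n + 2) - cheb_U n"

(* V_n and W_n are meaningful only for odd n = 2k+1, where n div 2 = k. *)
definition cheb_V :: "nat \<Rightarrow> int poly" where
  "cheb_V n = cheb_U (n div 2 + 1) - cheb_U (n div 2)"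

definition cheb_W :: "nat \<Rightarrow> int poly" where
  "cheb_W n = cheb_U (n div 2 + 1) + cheb_U (n div 2)"

definition eval_at :: "int poly \<Rightarrow> rat \<Rightarrow> rat" where
  "eval_at f q = poly (map_poly of_int f) q"

definition rat_num :: "rat \<Rightarrow> int" where
  "rat_num x = fst (quotient_of x)"

definition rat_den :: "rat \<Rightarrow> int" where
  "rat_den x = snd (quotient_of x)"

definition den_primes :: "rat \<Rightarrow> nat set" where
  "den_primes q = {p. prime p \<and> int p dvd rat_den q}"

definition odd_primes :: "nat set" where
  "odd_primes = {p. prime p \<and> odd p}"

(* The image of x in F_p, represented in {0..<p}; meaningful when p does not divide rat_den x. *)
definition residue_mod :: "nat \<Rightarrow> rat \<Rightarrow> int" where
  "residue_mod p x = rat_num x * modular_inverse (int p) (rat_den x) mod int p"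

definition rat_cong :: "nat \<Rightarrow> rat \<Rightarrow> rat \<Rightarrow> bool" where
  "rat_cong p x y \<longleftrightarrow>
     \<not> int p dvd rat_den x \<and> \<not> int p dvd rat_den y \<and> residue_mod p x = residue_mod p y"

fun Pi_class :: "rat \<Rightarrow> nat \<Rightarrow> nat set" where
  "Pi_class q 0 =
     {p \<in> odd_primes - den_primes q. \<exists>n. odd n \<and> rat_cong p (eval_at (cheb_W n) q) 0}"
| "Pi_class q (Suc 0) =
     {p \<in> odd_primes - den_primes q. \<exists>n. odd n \<and> rat_cong p (eval_at (cheb_V n) q) 0}"
| "Pi_class q (Suc (Suc k)) =
     {p \<in> odd_primes - den_primes q. \<exists>n. odd n \<and> rat_cong p (eval_at (cheb_C (2 ^ k * n)) q) 0}"

end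

theory Submission
  imports Defs
begin

text \<open>
  Reduce \<open>q\<close> to an integer \<open>x\<close> modulo \<open>p\<close>. The identities
  \<open>C\<^sub>n - 2 = (x - 2) W\<^sub>n\<^sup>2\<close> and \<open>C\<^sub>n + 2 = (x + 2) V\<^sub>n\<^sup>2\<close> for odd \<open>n\<close>, together with
  \<open>C\<^bsub>2n\<^esub> = C\<^sub>n\<^sup>2 - 2\<close>, express membership in class \<open>s\<close> through the values of \<open>C\<close> at
  \<open>2\<^sup>j n\<close>: these are \<open>2\<close> for \<open>j \<ge> s\<close> and \<open>-2\<close> for \<open>j = s - 1\<close>, a property stable under odd
  multiples of \<open>n\<close>, so taking a common odd multiple separates the classes as \<open>2 \<noteq> -2\<close> modulo \<open>p\<close>.
  Conversely \<open>U\<close> is periodic modulo \<open>p\<close>, so \<open>C\<close> takes the value \<open>2\<close> at some \<open>2\<^sup>i m\<close> with \<open>m\<close> odd, and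
  the least such \<open>i\<close> is the class of \<open>p\<close>, provided \<open>x \<noteq> 2, -2\<close>. If \<open>x\<close> is \<open>2\<close> or \<open>-2\<close>, then
  \<open>W\<^sub>p\<close> respectively \<open>V\<^sub>p\<close> vanishes.
\<close>

section \<open>Chebyshev identities\<close>

lemma poly_cheb_U_rec:
  "poly (cheb_U (Suc (Suc n))) x = x * poly (cheb_U (Suc n)) x - poly (cheb_U n) x"
  by simp

lemma poly_cheb_C_0: "poly (cheb_C 0) x = 2"
  by simp

lemma poly_cheb_C_1: "poly (cheb_C (Suc 0)) x = x"
  by (simp add: numeral_2_eq_2)

lemma poly_cheb_C_rec:
  "poly (cheb_C (Suc (Suc n))) x = x * poly (cheb_C (Suc n)) x - poly (cheb_C n) x"
  by (cases n) (simp_all add: numeral_2_eq_2 algebra_simps)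

lemmas poly_cheb_C = poly_cheb_C_0 poly_cheb_C_1 poly_cheb_C_rec

declare cheb_U.simps(3) [simp del] cheb_C.simps [simp del]

text \<open>The trace identity for powers of a determinant 1 matrix, with index
  \<open>a + 2 * n\<close> to avoid subtraction of naturals. Expanding the second factor by the
  recurrence calls the induction hypotheses at \<open>a + 1\<close> and \<open>a + 2\<close>, hence
  the arbitrary \<open>a\<close>.\<close>

lemma cheb_C_mult:
  "poly (cheb_C (a + n)) x * poly (cheb_C n) x = poly (cheb_C (a + 2 * n)) x + poly (cheb_C a) x"
proof (induction n arbitrary: a rule: induct_nat_012)
  case (ge2 n)
  have "poly (cheb_C (a + Suc (Suc n))) x * poly (cheb_C (Suc (Suc n))) x
      = x * (poly (cheb_C (Suc a + Suc n)) x * poly (cheb_C (Suc n)) x)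
        - poly (cheb_C (Suc (Suc a) + n)) x * poly (cheb_C n) x"
    by (simp add: poly_cheb_C_rec[of n] algebra_simps)
  also have "\<dots> = poly (cheb_C (a + 2 * Suc (Suc n))) x + poly (cheb_C a) x"
    unfolding ge2.IH by (simp add: poly_cheb_C_rec algebra_simps)
  finally show ?case .
qed (simp_all add: poly_cheb_C algebra_simps)

lemma cheb_C_double: "poly (cheb_C (2 * n)) x = (poly (cheb_C n) x)\<^sup>2 - 2"
  using cheb_C_mult[of 0 n x] by (simp add: poly_cheb_C power2_eq_square)

text \<open>The determinant of the \<open>n\<close>-th power of a matrix of trace \<open>x\<close> and determinant 1.\<close>
lemma cheb_U_det:
  "(poly (cheb_U (Suc n)) x)\<^sup>2 + (poly (cheb_U n) x)\<^sup>2
    = 1 + x * poly (cheb_U (Suc n)) x * poly (cheb_U n) x"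
proof (induction n)
  case (Suc n)
  then show ?case by (simp add: poly_cheb_U_rec power2_eq_square algebra_simps)
qed simp

text \<open>The first identity only serves to make the induction for the second one go through.\<close>
lemma cheb_C_eq_U:
  "poly (cheb_C (2 * k)) x = 2 + (x\<^sup>2 - 4) * (poly (cheb_U k) x)\<^sup>2 \<and>
   poly (cheb_C (2 * k + 1)) x = 2 + (x - 2) * (poly (cheb_U (k + 1)) x + poly (cheb_U k) x)\<^sup>2"
proof (induction k)
  case (Suc k)
  define a b c d where abcd: "a = poly (cheb_U (Suc k)) x" "b = poly (cheb_U k) x"
    "c = poly (cheb_C (2 * k)) x" "d = poly (cheb_C (Suc (2 * k))) x"
  have IH: "c = 2 + (x\<^sup>2 - 4) * b\<^sup>2" "d = 2 + (x - 2) * (a + b)\<^sup>2"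
    using Suc.IH by (simp_all add: abcd)
  have det: "a\<^sup>2 + b\<^sup>2 = 1 + x * a * b"
    using cheb_U_det[of k x] by (simp add: abcd)
  \<comment> \<open>The defect of the determinant relation. With it, both required formulas become
    polynomial identities up to the explicit multiple \<open>2 * (x - 2) * D\<close>, which
    vanishes.\<close>
  define D where "D = a\<^sup>2 + b\<^sup>2 - (1 + x * a * b)"
  have D: "D = 0" using det by (simp add: D_def)
  have "x * d - c = 2 + (x\<^sup>2 - 4) * a\<^sup>2 - 2 * (x - 2) * D"
    unfolding IH D_def by (simp add: power2_eq_square algebra_simps)
  with D have e: "x * d - c = 2 + (x\<^sup>2 - 4) * a\<^sup>2" by simp
  have "x * (x * d - c) - d = 2 + (x - 2) * ((x * a - b) + a)\<^sup>2 - 2 * (x - 2) * D"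
    unfolding e unfolding IH(2) D_def by (simp add: power2_eq_square algebra_simps)
  with D have "x * (x * d - c) - d = 2 + (x - 2) * ((x * a - b) + a)\<^sup>2" by simp
  with e show ?case
    by (simp add: abcd poly_cheb_U_rec poly_cheb_C_rec)
qed (simp add: poly_cheb_C)

lemma cheb_C_eq_W:
  assumes "odd n"
  shows "poly (cheb_C n) x - 2 = (x - 2) * (poly (cheb_W n) x)\<^sup>2"
proof -
  obtain k where "n = 2 * k + 1" using assms by (rule oddE)
  then show ?thesis using cheb_C_eq_U[of k x] by (simp add: cheb_W_def)
qed

lemma cheb_C_eq_V:
  assumes "odd n"
  shows "poly (cheb_C n) x + 2 = (x + 2) * (poly (cheb_V n) x)\<^sup>2"
proof -
  obtain k where n: "n = 2 * k + 1" using assms by (rule oddE)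
  have "poly (cheb_C n) x = 2 + (x - 2) * (poly (cheb_U (k + 1)) x + poly (cheb_U k) x)\<^sup>2"
    using cheb_C_eq_U[of k x] n by simp
  moreover have "poly (cheb_V n) x = poly (cheb_U (k + 1)) x - poly (cheb_U k) x"
    by (simp add: cheb_V_def n)
  \<comment> \<open>The correction term is a multiple of the determinant relation, hence
    zero.\<close>
  ultimately have "poly (cheb_C n) x + 2 = (x + 2) * (poly (cheb_V n) x)\<^sup>2
      - 4 * ((poly (cheb_U (k + 1)) x)\<^sup>2 + (poly (cheb_U k) x)\<^sup>2
        - (1 + x * poly (cheb_U (k + 1)) x * poly (cheb_U k) x))"
    by (simp only:) (simp add: power2_eq_square algebra_simps)
  then show ?thesis using cheb_U_det[of k x] by simp
qed

text \<open>Needed at the degenerate residues 2 and -2, where a factor \<open>x - 2\<close> or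
  \<open>x + 2\<close> vanishes and the square formulas say nothing about \<open>cheb_W\<close> or
  \<open>cheb_V\<close>.\<close>

lemma poly_cheb_U_2: "poly (cheb_U n) 2 = int n"
  by (induction n rule: induct_nat_012) (simp_all add: poly_cheb_U_rec)

lemma poly_cheb_U_neg_2: "poly (cheb_U n) (- 2) = - ((- 1) ^ n * int n)"
  by (induction n rule: induct_nat_012) (simp_all add: poly_cheb_U_rec algebra_simps)

lemma poly_cong:
  fixes f :: "int poly"
  assumes "[x = y] (mod m)"
  shows "[poly f x = poly f y] (mod m)"
  using assms by (induction f) (auto intro: cong_add cong_mult)

text \<open>The values at multiples of \<open>n\<close> satisfy the recurrence with parameter
  \<open>2 * e\<close>, whose characteristic polynomial has the double root \<open>e\<close>. For
  \<open>e = - 1\<close> odd multiples keep -2 and even ones give 2.\<close>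

lemma cheb_C_mult_cong:
  fixes e :: int
  assumes "[poly (cheb_C n) x = 2 * e] (mod p)" "e\<^sup>2 = 1"
  shows "[poly (cheb_C (m * n)) x = 2 * e ^ m] (mod p)"
proof (induction m rule: induct_nat_012)
  case (ge2 m)
  have mult: "Suc (Suc m) * n = m * n + 2 * n" "Suc m * n = m * n + n" by simp_all
  have "poly (cheb_C (Suc (Suc m) * n)) x
      = poly (cheb_C (Suc m * n)) x * poly (cheb_C n) x - poly (cheb_C (m * n)) x"
    using cheb_C_mult[of "m * n" n x] unfolding mult by simp
  also have "[\<dots> = 2 * e ^ Suc m * (2 * e) - 2 * e ^ m] (mod p)"
    using ge2 assms(1) by (intro cong_diff cong_mult)
  also have "2 * e ^ Suc m * (2 * e) - 2 * e ^ m = 2 * e ^ Suc (Suc m)"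
    using assms(2) by (simp add: power2_eq_square algebra_simps)
  finally show ?case .
qed (use assms in \<open>simp_all add: poly_cheb_C\<close>)

section \<open>Behaviour modulo a prime\<close>

text \<open>The recurrence can be run backwards, so a repeated pair of consecutive values descends
  to the initial pair (0, 1).\<close>

lemma cheb_U_shift_back:
  assumes "[poly (cheb_U (i + d)) x = poly (cheb_U i) x] (mod m)"
    and "[poly (cheb_U (Suc (i + d))) x = poly (cheb_U (Suc i)) x] (mod m)"
  shows "[poly (cheb_U d) x = 0] (mod m) \<and> [poly (cheb_U (Suc d)) x = 1] (mod m)"
  using assms
proof (induction i)
  case (Suc i)
  have U_eq: "poly (cheb_U n) x = x * poly (cheb_U (Suc n)) x - poly (cheb_U (Suc (Suc n))) x" for n
    by (simp add: poly_cheb_U_rec)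
  have "[poly (cheb_U (i + d)) x = poly (cheb_U i) x] (mod m)"
    unfolding U_eq[of "i + d"] U_eq[of i]
    using Suc.prems by (intro cong_diff cong_mult) simp_all
  with Suc show ?case by simp
qed simp

text \<open>Pigeonhole for the pairs of consecutive values of \<open>U\<close> modulo \<open>m\<close>.\<close>
lemma cheb_C_cong_2_ex:
  fixes m x :: int
  assumes "m > 0"
  obtains N where "N > 0" "[poly (cheb_C N) x = 2] (mod m)"
proof -
  define g where "g i = (poly (cheb_U i) x mod m, poly (cheb_U (Suc i)) x mod m)" for i
  have "range g \<subseteq> {0..<m} \<times> {0..<m}"
    using assms by (auto simp: g_def)
  then have "finite (range g)"
    by (rule finite_subset) simp
  then have "\<not> inj g"
    using finite_imageD infinite_UNIV_nat by blast
  then obtain i j where ij: "i < j" "g i = g j"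
    unfolding inj_def by (metis linorder_neqE_nat)
  \<comment> \<open>The period is \<open>Suc d\<close>, which makes its positivity evident.\<close>
  define d where "d = j - Suc i"
  have j: "j = i + Suc d" using ij by (simp add: d_def)
  have per: "[poly (cheb_U (Suc d)) x = 0] (mod m) \<and> [poly (cheb_U (Suc (Suc d))) x = 1] (mod m)"
    by (rule cheb_U_shift_back[of i]) (use ij(2) j in \<open>simp_all add: g_def cong_def\<close>)
  have "poly (cheb_C (Suc d)) x = 2 * poly (cheb_U (Suc (Suc d))) x - x * poly (cheb_U (Suc d)) x"
    by (simp add: cheb_C.simps poly_cheb_U_rec)
  also have "[\<dots> = 2 * 1 - x * 0] (mod m)"
    using per by (intro cong_diff cong_mult) simp_all
  finally show ?thesis by (intro that[of "Suc d"]) simp_all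
qed

section \<open>Classification of a prime by an integer residue\<close>

definition cheb_class :: "nat \<Rightarrow> int \<Rightarrow> nat \<Rightarrow> bool" where
  "cheb_class p x s \<longleftrightarrow> (\<exists>n. odd n \<and> int p dvd
     poly (case s of 0 \<Rightarrow> cheb_W n | Suc 0 \<Rightarrow> cheb_V n | Suc (Suc k) \<Rightarrow> cheb_C (2 ^ k * n)) x)"

text \<open>The free multiplier \<open>m\<close> lets witnesses of two different classes be brought
  to a common index.\<close>

lemma cheb_class_imp_C:
  assumes "cheb_class p x s"
  obtains n where "odd n" "\<And>m j. s \<le> j \<Longrightarrow> [poly (cheb_C (2 ^ j * (m * n))) x = 2] (mod int p)"
    "\<And>m j. s = Suc j \<Longrightarrow> odd m \<Longrightarrow> [poly (cheb_C (2 ^ j * (m * n))) x = - 2] (mod int p)"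
proof -
  have main: "\<exists>n. odd n \<and> (if s = 0 then [poly (cheb_C n) x = 2] (mod int p)
      else [poly (cheb_C (2 ^ (s - 1) * n)) x = - 2] (mod int p))"
  \<comment> \<open>The rule merely splits \<open>s\<close> into 0, 1 and
    \<open>k + 2\<close>.\<close>
  proof (cases s rule: cheb_U.cases)
    case 1
    then obtain n where n: "odd n" "int p dvd poly (cheb_W n) x"
      using assms by (auto simp: cheb_class_def)
    then have "int p dvd poly (cheb_C n) x - 2"
      unfolding cheb_C_eq_W[OF n(1)] by (simp add: power2_eq_square)
    with n(1) 1 show ?thesis by (auto simp: cong_iff_dvd_diff)
  next
    case 2
    then obtain n where n: "odd n" "int p dvd poly (cheb_V n) x"
      using assms by (auto simp: cheb_class_def)
    then have "int p dvd poly (cheb_C n) x + 2"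
      unfolding cheb_C_eq_V[OF n(1)] by (simp add: power2_eq_square)
    with n(1) 2 show ?thesis by (auto simp: cong_iff_dvd_diff)
  next
    case (3 k)
    then obtain n where n: "odd n" "int p dvd poly (cheb_C (2 ^ k * n)) x"
      using assms by (auto simp: cheb_class_def)
    have "poly (cheb_C (2 ^ Suc k * n)) x + 2 = (poly (cheb_C (2 ^ k * n)) x)\<^sup>2"
      using cheb_C_double[of "2 ^ k * n" x] by (simp add: mult.assoc)
    then have "int p dvd poly (cheb_C (2 ^ Suc k * n)) x + 2"
      using n(2) by (simp add: power2_eq_square)
    with n(1) 3 show ?thesis by (auto simp: cong_iff_dvd_diff)
  qed
  then obtain n where n: "odd n" "s = 0 \<Longrightarrow> [poly (cheb_C n) x = 2] (mod int p)"
      "s > 0 \<Longrightarrow> [poly (cheb_C (2 ^ (s - 1) * n)) x = - 2] (mod int p)"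
    by (auto split: if_splits)
  show ?thesis
  proof (rule that[OF n(1)])
    fix m j assume sj: "s \<le> j"
    show "[poly (cheb_C (2 ^ j * (m * n))) x = 2] (mod int p)"
    proof (cases s)
      case 0
      then show ?thesis
        using cheb_C_mult_cong[of n x 1 "int p" "2 ^ j * m"] n(2) by (simp add: mult.assoc)
    next
      case (Suc i)
      then have j: "j = i + Suc (j - s)" using sj by simp
      \<comment> \<open>The extra factor 2 makes the exponent of -1 even.\<close>
      have "2 ^ j * (m * n) = (2 * 2 ^ (j - s) * m) * (2 ^ i * n)"
        by (subst j) (simp only: power_add power_Suc ac_simps)
      moreover have "[poly (cheb_C ((2 * 2 ^ (j - s) * m) * (2 ^ i * n))) x = 2] (mod int p)"
        using cheb_C_mult_cong[of "2 ^ i * n" x "- 1" "int p" "2 * 2 ^ (j - s) * m"] n(3) Suc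
        by (simp add: power_mult)
      ultimately show ?thesis by (simp only:)
    qed
  next
    fix m j :: nat assume "s = Suc j" "odd m"
    then show "[poly (cheb_C (2 ^ j * (m * n))) x = - 2] (mod int p)"
      using cheb_C_mult_cong[of "2 ^ j * n" x "- 1" "int p" m] n(3)
      by (simp add: mult.left_commute)
  qed
qed

lemma cheb_class_unique:
  assumes "prime p" "odd p" "cheb_class p x s" "cheb_class p x s'"
  shows "s = s'"
proof -
  have False if lt: "s < s'" and s: "cheb_class p x s" and s': "cheb_class p x s'" for s s'
  proof -
    obtain n where n: "odd n"
      "\<And>m j. s \<le> j \<Longrightarrow> [poly (cheb_C (2 ^ j * (m * n))) x = 2] (mod int p)"
      using cheb_class_imp_C[OF s] by metis
    obtain n' where n': "odd n'"
      "\<And>m j. s' = Suc j \<Longrightarrow> odd m \<Longrightarrow> [poly (cheb_C (2 ^ j * (m * n'))) x = - 2] (mod int p)"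
      using cheb_class_imp_C[OF s'] by metis
    obtain j where j: "s' = Suc j" "s \<le> j" using lt by (cases s') auto
    \<comment> \<open>Here \<open>n'\<close> multiplies the witness \<open>n\<close>; in the next
      step the odd \<open>n\<close> multiplies the witness \<open>n'\<close>.\<close>
    have "[poly (cheb_C (2 ^ j * (n' * n))) x = 2] (mod int p)" using n(2) j by blast
    moreover have "[poly (cheb_C (2 ^ j * (n' * n))) x = - 2] (mod int p)"
      using n'(2)[OF j(1) n(1)] by (simp add: mult.commute)
    ultimately have "[2 = - 2] (mod int p)" by (metis cong_sym cong_trans)
    then have "p dvd 2 ^ 2" by (auto simp: cong_iff_dvd_diff simp flip: int_dvd_int_iff)
    then have "p dvd 2" using assms(1) prime_dvd_power by blast
    then show False using assms(1,2) by (metis primes_dvd_imp_eq two_is_prime_nat even_numeral)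
  qed
  with assms(3,4) show ?thesis by (metis linorder_neqE_nat)
qed

lemma cheb_class_ex:
  assumes "prime p" "odd p"
  shows "\<exists>s. cheb_class p x s"
proof -
  obtain k where k: "p = 2 * k + 1" using assms(2) by (rule oddE)
  have prime: "prime (int p)" using assms(1) by simp
  consider "[x = 2] (mod int p)" | "[x = - 2] (mod int p)"
    | "\<not> int p dvd x - 2" "\<not> int p dvd x + 2"
    by (auto simp: cong_iff_dvd_diff)
  then show ?thesis
  proof cases
    case 1
    have "poly (cheb_W p) 2 = int p"
      using k by (simp add: cheb_W_def poly_cheb_U_2)
    then have "int p dvd poly (cheb_W p) x"
      using poly_cong[OF 1, of "cheb_W p"] cong_dvd_iff by fastforce
    then have "cheb_class p x 0" using assms(2) by (auto simp: cheb_class_def)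
    then show ?thesis ..
  next
    case 2
    have "poly (cheb_V p) (- 2) = (- 1) ^ k * int p"
      using k by (simp add: cheb_V_def poly_cheb_U_neg_2 algebra_simps)
    then have "int p dvd poly (cheb_V p) x"
      using poly_cong[OF 2, of "cheb_V p"] cong_dvd_iff by fastforce
    then have "cheb_class p x (Suc 0)" using assms(2) by (auto simp: cheb_class_def)
    then show ?thesis ..
  next
    case 3
    obtain N where N: "N > 0" "[poly (cheb_C N) x = 2] (mod int p)"
      using cheb_C_cong_2_ex[of "int p" x] assms(1) prime_gt_0_nat by auto
    obtain m i where m: "N = 2 ^ i * m" "odd m"
      using N(1) multiplicity_decompose'[of N 2] by (metis not_gr_zero odd_one)
    define P where "P j \<longleftrightarrow> int p dvd poly (cheb_C (2 ^ j * m)) x - 2" for j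
    define s where "s = (LEAST j. P j)"
    have "P i" using N(2) m(1) by (simp add: P_def cong_iff_dvd_diff)
    then have Ps: "P s" unfolding s_def by (rule LeastI)
    have notP: "\<not> P j" if "j < s" for j using that unfolding s_def by (rule not_less_Least)
    have double: "poly (cheb_C (2 ^ Suc j * m)) x = (poly (cheb_C (2 ^ j * m)) x)\<^sup>2 - 2" for j
      using cheb_C_double[of "2 ^ j * m" x] by (simp add: mult.assoc)
    \<comment> \<open>Doubling gives a difference of squares. Minimality of \<open>s\<close>
      excludes the factor with -2, so the prime divides the other one.\<close>
    have pred: "int p dvd poly (cheb_C (2 ^ j * m)) x + 2" if j: "s = Suc j" for j
    proof -
      have "poly (cheb_C (2 ^ s * m)) x - 2
          = (poly (cheb_C (2 ^ j * m)) x - 2) * (poly (cheb_C (2 ^ j * m)) x + 2)"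
        unfolding j double by (simp add: power2_eq_square algebra_simps)
      then show ?thesis
        using Ps notP[of j] j prime by (simp add: P_def prime_dvd_mult_iff)
    qed
    have "cheb_class p x s"
    proof (cases s rule: cheb_U.cases)
      case 1
      then have "int p dvd (x - 2) * (poly (cheb_W m) x)\<^sup>2"
        using Ps cheb_C_eq_W[OF m(2), of x] by (simp add: P_def)
      then have "int p dvd poly (cheb_W m) x"
        using 3(1) prime by (simp add: prime_dvd_mult_iff prime_dvd_power_iff)
      then show ?thesis using m(2) 1 by (auto simp: cheb_class_def)
    next
      case 2
      then have "int p dvd (x + 2) * (poly (cheb_V m) x)\<^sup>2"
        using pred[of 0] cheb_C_eq_V[OF m(2), of x] by simp
      then have "int p dvd poly (cheb_V m) x"
        using 3(2) prime by (simp add: prime_dvd_mult_iff prime_dvd_power_iff)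
      then show ?thesis using m(2) 2 by (auto simp: cheb_class_def)
    next
      case (3 k)
      \<comment> \<open>One more halving: by \<open>double\<close>, adding 2 at index
        \<open>2 ^ Suc k * m\<close> leaves a square.\<close>
      then have "int p dvd poly (cheb_C (2 ^ k * m)) x"
        using pred[of "Suc k"] double[of k] prime by (simp add: prime_dvd_power_iff)
      then show ?thesis using m(2) 3 by (auto simp: cheb_class_def)
    qed
    then show ?thesis ..
  qed
qed

section \<open>Reduction of rationals modulo a prime\<close>

definition reduces_to :: "nat \<Rightarrow> rat \<Rightarrow> int \<Rightarrow> bool" where
  "reduces_to p y t \<longleftrightarrow>
     (\<exists>a b. \<not> int p dvd b \<and> y = of_int a / of_int b \<and> [a = t * b] (mod int p))"

lemma reduces_to_of_int: "prime p \<Longrightarrow> reduces_to p (of_int a) a"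
  unfolding reduces_to_def by (rule exI[of _ a], rule exI[of _ 1]) auto

lemma reduces_to_add:
  assumes "prime p" "reduces_to p y t" "reduces_to p y' t'"
  shows "reduces_to p (y + y') (t + t')"
proof -
  obtain a b where 1: "\<not> int p dvd b" "y = of_int a / of_int b" "[a = t * b] (mod int p)"
    using assms(2) by (auto simp: reduces_to_def)
  obtain a' b' where 2: "\<not> int p dvd b'" "y' = of_int a' / of_int b'" "[a' = t' * b'] (mod int p)"
    using assms(3) by (auto simp: reduces_to_def)
  have "b \<noteq> 0" "b' \<noteq> 0" using 1 2 by auto
  then have "y + y' = of_int (a * b' + a' * b) / of_int (b * b')"
    using 1(2) 2(2) by (simp add: field_simps)
  moreover have "\<not> int p dvd b * b'"
    using 1(1) 2(1) assms(1) by (simp add: prime_dvd_mult_iff)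
  moreover have "[a * b' + a' * b = t * b * b' + t' * b' * b] (mod int p)"
    using 1(3) 2(3) by (intro cong_add cong_mult) auto
  then have "[a * b' + a' * b = (t + t') * (b * b')] (mod int p)"
    by (simp add: algebra_simps)
  ultimately show ?thesis unfolding reduces_to_def by blast
qed

lemma reduces_to_mult:
  assumes "prime p" "reduces_to p y t" "reduces_to p y' t'"
  shows "reduces_to p (y * y') (t * t')"
proof -
  obtain a b where 1: "\<not> int p dvd b" "y = of_int a / of_int b" "[a = t * b] (mod int p)"
    using assms(2) by (auto simp: reduces_to_def)
  obtain a' b' where 2: "\<not> int p dvd b'" "y' = of_int a' / of_int b'" "[a' = t' * b'] (mod int p)"
    using assms(3) by (auto simp: reduces_to_def)
  have "y * y' = of_int (a * a') / of_int (b * b')"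
    using 1(2) 2(2) by simp
  moreover have "\<not> int p dvd b * b'"
    using 1(1) 2(1) assms(1) by (simp add: prime_dvd_mult_iff)
  moreover have "[a * a' = (t * b) * (t' * b')] (mod int p)"
    using 1(3) 2(3) by (intro cong_mult)
  then have "[a * a' = (t * t') * (b * b')] (mod int p)"
    by (simp add: algebra_simps)
  ultimately show ?thesis unfolding reduces_to_def by blast
qed

lemma reduces_to_eval_at:
  assumes "prime p" "reduces_to p q t"
  shows "reduces_to p (eval_at f q) (poly f t)"
proof (induction f)
  case 0
  then show ?case using reduces_to_of_int[OF assms(1), of 0] by (simp add: eval_at_def)
next
  case (pCons a f)
  have "eval_at (pCons a f) q = of_int a + q * eval_at f q"
    using pCons.hyps by (simp add: eval_at_def map_poly_pCons)
  then show ?case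
    using assms pCons.IH
    by (simp add: reduces_to_add reduces_to_mult reduces_to_of_int)
qed

lemma rat_num_den: "y = of_int (rat_num y) / of_int (rat_den y)"
  unfolding rat_num_def rat_den_def by (rule quotient_of_div) simp

lemma rat_den_pos: "rat_den y > 0"
  unfolding rat_den_def by (rule quotient_of_denom_pos')

lemma coprime_rat_num_den: "coprime (rat_num y) (rat_den y)"
  unfolding rat_num_def rat_den_def by (rule quotient_of_coprime) simp

lemma reduces_to_ex:
  assumes "prime p" "\<not> int p dvd rat_den q"
  shows "\<exists>t. reduces_to p q t"
proof -
  have "coprime (rat_den q) (int p)"
    using prime_imp_coprime[of "int p" "rat_den q"] assms by (simp add: coprime_commute)
  then obtain r where r: "[rat_den q * r = 1] (mod int p)"
    using cong_solve_coprime_int by blast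
  have "[rat_num q * (rat_den q * r) = rat_num q * 1] (mod int p)"
    using r by (intro cong_mult) simp_all
  then have "[rat_num q = (rat_num q * r) * rat_den q] (mod int p)"
    by (simp add: ac_simps cong_sym_eq)
  then show ?thesis
    unfolding reduces_to_def using assms(2) rat_num_den by blast
qed

lemma rat_cong_0_iff:
  assumes "prime p" "reduces_to p y t"
  shows "rat_cong p y 0 \<longleftrightarrow> int p dvd t"
proof -
  have prime: "prime (int p)" using assms(1) by simp
  obtain a b where ab: "\<not> int p dvd b" "y = of_int a / of_int b" "[a = t * b] (mod int p)"
    using assms(2) by (auto simp: reduces_to_def)
  have "b \<noteq> 0" using ab by auto
  have "of_int (rat_num y) / of_int (rat_den y) = (of_int a / of_int b :: rat)"
    using rat_num_den[of y] ab(2) by simp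
  then have "of_int (rat_num y * b) = (of_int (a * rat_den y) :: rat)"
    using \<open>b \<noteq> 0\<close> rat_den_pos[of y] by (simp add: frac_eq_eq)
  then have eq: "rat_num y * b = a * rat_den y" by (simp only: of_int_eq_iff)
  \<comment> \<open>Cross multiplication would otherwise put \<open>p\<close> into the reduced
    numerator as well, against coprimality.\<close>
  have den: "\<not> int p dvd rat_den y"
  proof
    assume d: "int p dvd rat_den y"
    then have "int p dvd rat_num y"
      using eq ab(1) prime by (metis dvd_mult prime_dvd_mult_iff)
    with d show False
      using coprime_rat_num_den[of y] prime by (metis coprime_common_divisor not_prime_unit)
  qed
  then have cop: "coprime (rat_den y) (int p)"
    using prime_imp_coprime[OF prime] by (simp add: coprime_commute)
  have "rat_num 0 = 0" "rat_den 0 = 1" by (simp_all add: rat_num_def rat_den_def)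
  then have "rat_cong p y 0 \<longleftrightarrow> int p dvd rat_num y * modular_inverse (int p) (rat_den y)"
    using den assms(1) by (auto simp: rat_cong_def residue_mod_def)
  also have "\<dots> \<longleftrightarrow> int p dvd rat_num y"
  proof -
    have "\<not> int p dvd modular_inverse (int p) (rat_den y)"
      using cong_modular_inverse1[OF cop] prime
      by (metis cong_dvd_iff dvd_mult not_prime_unit)
    then show ?thesis using prime by (simp add: prime_dvd_mult_iff)
  qed
  also have "\<dots> \<longleftrightarrow> int p dvd a"
    using eq den ab(1) prime by (metis prime_dvd_mult_iff)
  also have "\<dots> \<longleftrightarrow> int p dvd t"
    using ab(1,3) prime by (metis cong_dvd_iff prime_dvd_mult_iff)
  finally show ?thesis .
qed

section \<open>Transfer to the classes of a rational number\<close>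

lemma Pi_class_iff:
  assumes "p \<in> odd_primes - den_primes q" "reduces_to p q t"
  shows "p \<in> Pi_class q s \<longleftrightarrow> cheb_class p t s"
proof -
  have "prime p" using assms(1) by (simp add: odd_primes_def)
  then have "rat_cong p (eval_at f q) 0 \<longleftrightarrow> int p dvd poly f t" for f
    using assms(2) by (intro rat_cong_0_iff reduces_to_eval_at)
  with assms(1) show ?thesis
    by (cases s rule: cheb_U.cases) (simp_all add: cheb_class_def)
qed

theorem theorem1:
  fixes q :: rat
  shows "disjoint_family (Pi_class q) \<and>
         (\<Union>s. Pi_class q s) = odd_primes - den_primes q"
proof -
  have sub: "Pi_class q s \<subseteq> odd_primes - den_primes q" for s
    by (cases s rule: cheb_U.cases) auto
  \<comment> \<open>A single residue \<open>t\<close> serves all classes at once, as uniqueness and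
    existence require.\<close>
  have reduce: "prime p \<and> odd p \<and> (\<exists>t. \<forall>s. p \<in> Pi_class q s \<longleftrightarrow> cheb_class p t s)"
    if p: "p \<in> odd_primes - den_primes q" for p
  proof -
    have "prime p" "odd p" "\<not> int p dvd rat_den q"
      using p by (auto simp: odd_primes_def den_primes_def)
    moreover from this obtain t where "reduces_to p q t" using reduces_to_ex by blast
    ultimately show ?thesis using Pi_class_iff[OF p] by blast
  qed
  have "s = s'" if "p \<in> Pi_class q s" "p \<in> Pi_class q s'" for p s s'
  proof -
    have "p \<in> odd_primes - den_primes q" using that(1) sub by blast
    then obtain t where "prime p" "odd p" "\<And>s. p \<in> Pi_class q s \<longleftrightarrow> cheb_class p t s"
      using reduce by blast
    with that show ?thesis using cheb_class_unique by simp
  qed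
  then have "disjoint_family (Pi_class q)"
    unfolding disjoint_family_on_def by blast
  moreover have "odd_primes - den_primes q \<subseteq> (\<Union>s. Pi_class q s)"
  proof
    fix p assume "p \<in> odd_primes - den_primes q"
    then obtain t where "prime p" "odd p" "\<And>s. p \<in> Pi_class q s \<longleftrightarrow> cheb_class p t s"
      using reduce by blast
    then show "p \<in> (\<Union>s. Pi_class q s)" using cheb_class_ex[of p t] by simp
  qed
  ultimately show ?thesis using sub by blast
qed

end
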